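(* Let $n \geq 1$ be an integer and let $\ell=\lfloor n/2\rfloor$. Then $$\sum_{s=0}^{\ell} T_{n+1}^{(s)}(x)=(\ell+1)T_{n+1}(x)-\sum_{j=1}^{n-1}\left(xT_j(x)+T_{j-1}(x)\right)T_{n-j}(x).$$
   Context: The tribonacci polynomials $T_n(x)$ are defined by $T_0(x)=0$, $T_1(x)=1$, $T_2(x)=x^2$ and $T_n(x)=x^2T_{n-1}(x)+xT_{n-2}(x)+T_{n-3}(x)$ for $n\ge 3$. For integers $n\ge 0$ and $0\le s\le \lfloor n/2\rfloor$, the incomplete tribonacci polynomial is defined by $$T_{n+1}^{(s)}(x)=\sum_{i=0}^{s}\sum_{j=0}^i \binom{i}{j}\binom{n-i-j}{i}x^{2n-3(i+j)}.$$ *)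

theory Defs
  imports "HOL-Computational_Algebra.Polynomial"
begin

abbreviation X :: "int poly" where
  "X \<equiv> [:0, 1:]"

fun tribonacci :: "nat \<Rightarrow> int poly" where
  "tribonacci 0 = 0"
| "tribonacci (Suc 0) = 1"
| "tribonacci (Suc (Suc 0)) = X ^ 2"
| "tribonacci (Suc (Suc (Suc n))) =
     X ^ 2 * tribonacci (Suc (Suc n)) + X * tribonacci (Suc n) + tribonacci n"

(* The argument Suc n is the subscript n + 1; subscript 0 is a dummy value. The intended range is
   s \<le> n div 2: there i + j \<le> n, so n - i - j is not truncated, and whenever
   (n - i - j) choose i is nonzero we have 2 * i + j \<le> n and j \<le> i, hence
   3 * (i + j) \<le> 2 * n, so that the exponent is truncated only in vanishing terms. *)
fun incomplete_tribonacci :: "nat \<Rightarrow> nat \<Rightarrow> int poly" where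
  "incomplete_tribonacci 0 s = 0"
| "incomplete_tribonacci (Suc n) s =
     (\<Sum>i=0..s. \<Sum>j=0..i.
        of_nat (i choose j) * of_nat ((n - i - j) choose i) * X ^ (2 * n - 3 * (i + j)))"

end

theory Submission
  imports Defs "HOL-Computational_Algebra.Formal_Power_Series"
begin

text \<open>
  The proof works in formal power series over the integer polynomials, with \<open>t\<close> as the formal
  variable and \<open>x\<close> as a constant. Put \<open>P = 1 - x^2 t\<close> and \<open>Q = x t^2 + t^3\<close>. The tribonacci recurrence
  says that \<open>F = (\<Sum>n. T_(n+1) t^n)\<close> equals \<open>1 / (P - Q)\<close>, and expanding this geometrically gives
  \<open>F = (\<Sum>i. Q^i / P^(i+1))\<close>. By the binomial theorem and the negative binomial series, the
  coefficient of \<open>t^n\<close> in \<open>Q^i / P^(i+1)\<close> is exactly the inner sum over \<open>j\<close> in the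
  definition of the incomplete polynomials, so these have the partial sums \<open>S_s\<close> of the
  geometric series as generating functions (\<open>incomplete_tribonacci_Suc_eq_nth\<close>).

  Summing the geometric series twice then yields the identity. Once gives
  \<open>S_s = F - F Q^(s+1) / P^(s+1)\<close>; the corrections \<open>Q^(s+1) / P^(s+1)\<close> for \<open>s \<le> l\<close> add up to \<open>Q S_l\<close>,
  so applying the formula again to \<open>S_l\<close> shows
  \<open>(\<Sum>s\<le>l. S_s) = (l+1) F - F^2 Q + F^2 Q^(l+2) / P^(l+1)\<close>.
  The last term is a multiple of \<open>t^(2l+4)\<close> and does not reach \<open>t^n\<close> when \<open>l = n div 2\<close>, while
  the coefficients of \<open>F \<cdot> Q F\<close> are the convolution sum of the theorem.
\<close>

section \<open>Negative binomial series\<close>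

text \<open>This is the series of \<open>1 / (1 - c t)^(i+1)\<close>, written by its coefficients because the
  coefficient ring is not a field.\<close>

definition neg_binomial_fps :: "'a::comm_ring_1 \<Rightarrow> nat \<Rightarrow> 'a fps" where
  "neg_binomial_fps c i = Abs_fps (\<lambda>k. of_nat ((k + i) choose i) * c ^ k)"

lemma neg_binomial_fps_0:
  "(1 - fps_const c * fps_X) * neg_binomial_fps c 0 = 1"
proof (rule fps_ext)
  fix k
  show "fps_nth ((1 - fps_const c * fps_X) * neg_binomial_fps c 0) k = fps_nth 1 k"
    by (cases k) (simp_all add: neg_binomial_fps_def left_diff_distrib mult.assoc)
qed

text \<open>On coefficients this is Pascal's rule.\<close>

lemma neg_binomial_fps_Suc:
  "(1 - fps_const c * fps_X) * neg_binomial_fps c (Suc i) = neg_binomial_fps c i"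
proof (rule fps_ext)
  fix k
  show "fps_nth ((1 - fps_const c * fps_X) * neg_binomial_fps c (Suc i)) k
      = fps_nth (neg_binomial_fps c i) k"
    by (cases k) (simp_all add: neg_binomial_fps_def algebra_simps binomial_eq_0)
qed

section \<open>Geometric sums\<close>

text \<open>With \<open>G i = 1 / P^(i+1)\<close> the summands form the geometric series of \<open>1 / (P - Q)\<close>; the
  product telescopes.\<close>

lemma geometric_partial_sum:
  fixes P Q :: "'a::comm_ring_1"
  assumes "P * G 0 = 1" and "\<And>i. P * G (Suc i) = G i"
  shows "(P - Q) * (\<Sum>i\<le>s. Q ^ i * G i) = 1 - Q ^ Suc s * G s"
proof (induction s)
  case 0
  show ?case using assms(1) by (simp add: algebra_simps)
next
  case (Suc s)
  have "(P - Q) * (Q ^ Suc s * G (Suc s))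
      = Q ^ Suc s * (P * G (Suc s)) - Q ^ Suc (Suc s) * G (Suc s)"
    by (simp add: algebra_simps)
  then show ?case
    using Suc by (simp add: assms(2) distrib_left)
qed

text \<open>The error terms of the partial sums are themselves \<open>F Q\<close> times the summands of the same
  series, so the formula for partial sums can be used a second time.\<close>

lemma geometric_double_sum:
  fixes P Q F :: "'a::comm_ring_1"
  assumes G: "P * G 0 = 1" "\<And>i. P * G (Suc i) = G i" and F: "(P - Q) * F = 1"
  shows "(\<Sum>s\<le>l. \<Sum>i\<le>s. Q ^ i * G i)
    = of_nat (l + 1) * F - F * (Q * F) + Q ^ (l + 2) * (F * F * G l)"
proof -
  have S: "(\<Sum>i\<le>s. Q ^ i * G i) = F - F * Q * (Q ^ s * G s)" for s
  proof -
    have "(\<Sum>i\<le>s. Q ^ i * G i) = ((P - Q) * F) * (\<Sum>i\<le>s. Q ^ i * G i)"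
      by (simp only: F mult_1_left)
    also have "\<dots> = F * ((P - Q) * (\<Sum>i\<le>s. Q ^ i * G i))"
      by (simp only: mult_ac)
    also have "\<dots> = F * (1 - Q ^ Suc s * G s)"
      by (simp only: geometric_partial_sum[where G = G and P = P, OF G])
    finally show ?thesis
      by (simp only: right_diff_distrib mult_1_right power_Suc mult_ac)
  qed
  have "(\<Sum>s\<le>l. \<Sum>i\<le>s. Q ^ i * G i) = (\<Sum>s\<le>l. F - F * Q * (Q ^ s * G s))"
    by (simp only: S)
  also have "\<dots> = of_nat (l + 1) * F - F * Q * (\<Sum>s\<le>l. Q ^ s * G s)"
    by (simp add: sum_subtractf sum_distrib_left)
  also have "\<dots> = of_nat (l + 1) * F - F * Q * (F - F * Q * (Q ^ l * G l))"
    by (simp only: S)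
  finally show ?thesis by (simp add: algebra_simps)
qed

section \<open>Generating functions of the tribonacci polynomials\<close>

definition trib_P :: "int poly fps" where
  "trib_P = 1 - fps_const (X ^ 2) * fps_X"

definition trib_Q :: "int poly fps" where
  "trib_Q = fps_X ^ 2 * (fps_const X + fps_X)"

definition trib_fps :: "int poly fps" where
  "trib_fps = Abs_fps (\<lambda>n. tribonacci (n + 1))"

text \<open>The truncated subtractions are harmless: for \<open>n \<le> 1\<close> both indices become \<open>0\<close>, and
  \<open>tribonacci 0 = 0\<close>.\<close>

lemma nth_trib_Q_mult_trib_fps:
  "fps_nth (trib_Q * trib_fps) n = X * tribonacci (n - 1) + tribonacci (n - 2)"
proof -
  have "trib_Q * trib_fps = fps_X ^ 2 * (fps_const X * trib_fps + fps_X * trib_fps)"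
    by (simp add: trib_Q_def algebra_simps)
  then have nth: "fps_nth (trib_Q * trib_fps) n = (if n < 2 then 0
      else X * fps_nth trib_fps (n - 2) + fps_nth (fps_X * trib_fps) (n - 2))"
    by (simp only: fps_X_power_mult_nth fps_add_nth fps_mult_left_const_nth)
  show ?thesis
    unfolding nth by (cases n rule: tribonacci.cases) (simp_all add: trib_fps_def)
qed

lemma trib_fps_inverse: "(trib_P - trib_Q) * trib_fps = 1"
proof (rule fps_ext)
  fix n
  have "(trib_P - trib_Q) * trib_fps
      = trib_fps - fps_const (X ^ 2) * (fps_X * trib_fps) - trib_Q * trib_fps"
    by (simp add: trib_P_def algebra_simps)
  then have nth: "fps_nth ((trib_P - trib_Q) * trib_fps) n
      = tribonacci (n + 1) - X ^ 2 * (if n = 0 then 0 else tribonacci n)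
        - (X * tribonacci (n - 1) + tribonacci (n - 2))"
    by (simp only: fps_sub_nth nth_trib_Q_mult_trib_fps fps_mult_left_const_nth)
      (simp add: trib_fps_def)
  show "fps_nth ((trib_P - trib_Q) * trib_fps) n = fps_nth 1 n"
    unfolding nth by (cases n rule: tribonacci.cases) simp_all
qed

lemma nth_trib_Q_power_mult:
  "fps_nth (trib_Q ^ i * g) n
    = (if n < 2 * i then 0 else fps_nth ((fps_const X + fps_X) ^ i * g) (n - 2 * i))"
proof -
  have "trib_Q ^ i * g = fps_X ^ (2 * i) * ((fps_const X + fps_X) ^ i * g)"
    by (simp add: trib_Q_def power_mult_distrib power_mult mult.assoc)
  then show ?thesis by (simp only: fps_X_power_mult_nth)
qed

text \<open>Expanding \<open>Q^i = t^(2i) (x + t)^i\<close> by the binomial theorem, the summand \<open>j\<close> picks the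
  coefficient of index \<open>n - 2i - j\<close> from the negative binomial series. If that index is negative, the
  binomial coefficient \<open>(n - i - j) choose i\<close> vanishes as well.\<close>

lemma nth_trib_Q_power_mult_neg_binomial:
  "fps_nth (trib_Q ^ i * neg_binomial_fps (X ^ 2) i) n
    = (\<Sum>j=0..i. of_nat (i choose j) * of_nat ((n - i - j) choose i) * X ^ (2 * n - 3 * (i + j)))"
proof -
  let ?G = "neg_binomial_fps (X ^ 2) i"
  have expand: "trib_Q ^ i * ?G
      = (\<Sum>j=0..i. fps_const (of_nat (i choose j) * X ^ (i - j)) * (fps_X ^ (2 * i + j) * ?G))"
  proof -
    have "(fps_const X + fps_X) ^ i
        = (\<Sum>j=0..i. of_nat (i choose j) * fps_X ^ j * fps_const X ^ (i - j))"
      by (subst add.commute) (simp only: binomial_ring atLeast0AtMost)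
    then show ?thesis
      by (simp add: trib_Q_def power_mult_distrib power_mult[symmetric] sum_distrib_left
          sum_distrib_right power_add fps_of_nat[symmetric]
          fps_const_mult[symmetric] mult_ac del: fps_const_mult)
  qed
  have "of_nat (i choose j) * X ^ (i - j) * fps_nth (fps_X ^ (2 * i + j) * ?G) n
      = of_nat (i choose j) * of_nat ((n - i - j) choose i) * X ^ (2 * n - 3 * (i + j))"
    if "j \<le> i" for j
  proof (cases "n < 2 * i + j")
    case True
    then have "n - i - j < i" using that by linarith
    then show ?thesis using True by (simp add: fps_X_power_mult_nth)
  next
    case False
    define d k where "d = i - j" and "k = n - (2 * i + j)"
    have i: "i = j + d" using that by (simp add: d_def)
    have n: "n = 2 * i + j + k" using False by (simp add: k_def)
    have index: "n - i - j = k + i" by (simp add: n)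
    have exponent: "2 * n - 3 * (i + j) = d + 2 * k" by (simp add: n i)
    have power: "X ^ (i - j) * (X ^ 2) ^ k = X ^ (2 * n - 3 * (i + j))"
      by (simp only: d_def[symmetric] exponent power_add power_mult)
    have nth: "fps_nth (fps_X ^ (2 * i + j) * ?G) n = of_nat ((k + i) choose i) * (X ^ 2) ^ k"
      by (simp only: fps_X_power_mult_nth False if_False k_def[symmetric] neg_binomial_fps_def
          fps_nth_Abs_fps)
    show ?thesis
      unfolding nth index power[symmetric] by (simp only: mult_ac)
  qed
  then show ?thesis
    unfolding expand fps_sum_nth fps_mult_left_const_nth by (intro sum.cong) auto
qed

lemma incomplete_tribonacci_Suc_eq_nth:
  "incomplete_tribonacci (Suc n) s
    = fps_nth (\<Sum>i\<le>s. trib_Q ^ i * neg_binomial_fps (X ^ 2) i) n"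
  by (simp only: incomplete_tribonacci.simps fps_sum_nth nth_trib_Q_power_mult_neg_binomial
      atLeast0AtMost)

text \<open>The Cauchy product has no contributions from \<open>j \<le> 1\<close>; the remaining indices are shifted
  by one.\<close>

lemma nth_trib_fps_convolution:
  assumes "n \<ge> 1"
  shows "fps_nth (trib_fps * (trib_Q * trib_fps)) n
    = (\<Sum>j=1..n - 1. (X * tribonacci j + tribonacci (j - 1)) * tribonacci (n - j))"
proof -
  let ?f = "\<lambda>j. (X * tribonacci (j - 1) + tribonacci (j - 2)) * tribonacci (n - j + 1)"
  have "fps_nth (trib_fps * (trib_Q * trib_fps)) n = (\<Sum>j=0..n. ?f j)"
    unfolding mult.commute[of trib_fps] fps_mult_nth[of "trib_Q * trib_fps"]
      nth_trib_Q_mult_trib_fps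
    by (simp add: trib_fps_def mult.commute)
  also have "\<dots> = (\<Sum>j=Suc 1..Suc (n - 1). ?f j)"
  proof (rule sum.mono_neutral_right)
    show "\<forall>j\<in>{0..n} - {Suc 1..Suc (n - 1)}. ?f j = 0"
    proof
      fix j
      assume "j \<in> {0..n} - {Suc 1..Suc (n - 1)}"
      then have "j - 1 = 0" "j - 2 = 0" by auto
      then show "?f j = 0" by simp
    qed
  qed (use assms in auto)
  also have "\<dots> = (\<Sum>j=1..n - 1. ?f (Suc j))"
    by (rule sum.shift_bounds_cl_Suc_ivl)
  also have "\<dots> = (\<Sum>j=1..n - 1. (X * tribonacci j + tribonacci (j - 1)) * tribonacci (n - j))"
  proof (rule sum.cong)
    fix j
    assume "j \<in> {1..n - 1}"
    then have "n - Suc j + 1 = n - j" "Suc j - 1 = j" "Suc j - 2 = j - 1" by auto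
    then show "?f (Suc j) = (X * tribonacci j + tribonacci (j - 1)) * tribonacci (n - j)"
      by simp
  qed simp
  finally show ?thesis .
qed

section \<open>The sum of the incomplete tribonacci polynomials\<close>

theorem mainTheorem3:
  fixes n l :: nat
  assumes "n \<ge> 1" and "l = n div 2"
  shows "(\<Sum>s=0..l. incomplete_tribonacci (n + 1) s) =
    of_nat (l + 1) * tribonacci (n + 1) -
    (\<Sum>j=1..n - 1. (X * tribonacci j + tribonacci (j - 1)) * tribonacci (n - j))"
proof -
  let ?G = "neg_binomial_fps (X ^ 2)"
  have "(\<Sum>s=0..l. incomplete_tribonacci (n + 1) s)
      = fps_nth (\<Sum>s\<le>l. \<Sum>i\<le>s. trib_Q ^ i * ?G i) n"
    by (simp only: Suc_eq_plus1[symmetric] incomplete_tribonacci_Suc_eq_nth fps_sum_nth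
        atLeast0AtMost)
  also have "(\<Sum>s\<le>l. \<Sum>i\<le>s. trib_Q ^ i * ?G i)
      = of_nat (l + 1) * trib_fps - trib_fps * (trib_Q * trib_fps)
        + trib_Q ^ (l + 2) * (trib_fps * trib_fps * ?G l)"
    by (rule geometric_double_sum[where P = trib_P])
      (simp_all only: trib_P_def neg_binomial_fps_0 neg_binomial_fps_Suc
        trib_fps_inverse[unfolded trib_P_def])
  also have "fps_nth \<dots> n = fps_nth (of_nat (l + 1) * trib_fps) n
      - fps_nth (trib_fps * (trib_Q * trib_fps)) n"
  proof -
    have "n < 2 * (l + 2)" unfolding assms(2) by presburger
    then show ?thesis
      by (simp only: fps_add_nth fps_sub_nth nth_trib_Q_power_mult if_True add_0_right)
  qed
  also have "fps_nth (of_nat (l + 1) * trib_fps) n = of_nat (l + 1) * tribonacci (n + 1)"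
    by (simp only: fps_of_nat[symmetric] fps_mult_left_const_nth) (simp add: trib_fps_def)
  finally show ?thesis
    by (simp only: nth_trib_fps_convolution[OF assms(1)])
qed

end
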